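(* Let $d$ be a positive integer divisible by $4$ and let $H_d$ be the Hadamard graph: its vertex set is $\{0,1\}^d$ ($N=2^d$ vertices), and two vertices are adjacent iff they differ in exactly $d/2$ coordinates. Consider the equality problem defined by $H_d$: Alice receives a vertex $x$, Bob a vertex $y$, with the promise that $x=y$ or $x$ is adjacent to $y$; Bob outputs $z\in\{1,2\}$ and the success metric is $\mathcal{S}=\frac{1}{\sum_xN_x+N}\sum_y\big(p(1|y,y)+\sum_{x\sim y}p(2|x,y)\big)$, where $N_x$ is the degree of $x$. There exists a quantum protocol achieving $\mathcal{S}=1$ with quantum distinguishability $\mathcal{D}_Q$ such that every classical protocol achieving $\mathcal{S}=1$ has classical distinguishability $\mathcal{D}_C$ with $$\frac{\mathcal{D}_C}{\mathcal{D}_Q}\ge\frac{(1.005)^d}{d}.$$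
   Context: Quantum protocol: Alice sends density operators $\rho_x$ on $\mathbb{C}^{k}$ (any $k$), Bob measures POVMs $\{M_{z|y}\}_z$, $p(z|x,y)=\operatorname{tr}(\rho_xM_{z|y})$; quantum distinguishability $\mathcal{D}_Q=\max_{\{M_x\}}\frac1N\sum_x\operatorname{tr}(\rho_xM_x)$ over POVMs. Classical protocol: encoding $p_e(m|x)$ over messages from a finite set of arbitrary size, decoding $p_d(z|y,m)$, $p(z|x,y)=\sum_mp_e(m|x)p_d(z|y,m)$; classical distinguishability $\mathcal{D}_C=\frac1N\sum_m\max_xp_e(m|x)$. *)

theory Defs
  imports Complex_Main "Jordan_Normal_Form.Matrix"
begin

type_synonym vtx = "bool list"

definition hverts :: "nat \<Rightarrow> vtx set" where
  "hverts d = {x. length x = d}"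

definition hadj :: "nat \<Rightarrow> vtx \<Rightarrow> vtx \<Rightarrow> bool" where
  "hadj d x y \<longleftrightarrow> x \<in> hverts d \<and> y \<in> hverts d \<and>
     card {i. i < d \<and> x ! i \<noteq> y ! i} = d div 2"

definition hnbrs :: "nat \<Rightarrow> vtx \<Rightarrow> vtx set" where
  "hnbrs d y = {x \<in> hverts d. hadj d x y}"

definition success :: "nat \<Rightarrow> (vtx \<Rightarrow> vtx \<Rightarrow> nat \<Rightarrow> real) \<Rightarrow> real" where
  "success d p = (1 / (real (\<Sum>x\<in>hverts d. card (hnbrs d x)) + real (card (hverts d)))) *
     (\<Sum>y\<in>hverts d. p y y 1 + (\<Sum>x\<in>hnbrs d y. p x y 2))"

definition mtrace :: "complex mat \<Rightarrow> complex" where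
  "mtrace A = (\<Sum>i<dim_row A. A $$ (i, i))"

text \<open>Positive semidefinite k x k complex matrix (order on complex: 0 \<le> z iff z real and nonnegative).\<close>
definition psd :: "nat \<Rightarrow> complex mat \<Rightarrow> bool" where
  "psd k A \<longleftrightarrow> A \<in> carrier_mat k k \<and>
     (\<forall>v \<in> carrier_vec k. 0 \<le> conjugate v \<bullet> (A *\<^sub>v v))"

definition density :: "nat \<Rightarrow> complex mat \<Rightarrow> bool" where
  "density k \<rho> \<longleftrightarrow> psd k \<rho> \<and> mtrace \<rho> = 1"

definition povm :: "nat \<Rightarrow> ('o \<Rightarrow> complex mat) \<Rightarrow> 'o set \<Rightarrow> bool" where
  "povm k E Outs \<longleftrightarrow> finite Outs \<and> (\<forall>w\<in>Outs. psd k (E w)) \<and>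
     (\<forall>i<k. \<forall>j<k. (\<Sum>w\<in>Outs. E w $$ (i, j)) = (if i = j then 1 else 0))"

definition qprotocol :: "nat \<Rightarrow> nat \<Rightarrow> (vtx \<Rightarrow> complex mat) \<Rightarrow> (vtx \<Rightarrow> nat \<Rightarrow> complex mat) \<Rightarrow> bool" where
  "qprotocol d k \<rho> M \<longleftrightarrow> (\<forall>x\<in>hverts d. density k (\<rho> x)) \<and>
     (\<forall>y\<in>hverts d. povm k (M y) {1, 2})"

definition qprob :: "(vtx \<Rightarrow> complex mat) \<Rightarrow> (vtx \<Rightarrow> nat \<Rightarrow> complex mat) \<Rightarrow> vtx \<Rightarrow> vtx \<Rightarrow> nat \<Rightarrow> real" where
  "qprob \<rho> M x y z = Re (mtrace (\<rho> x * M y z))"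

definition DQ :: "nat \<Rightarrow> nat \<Rightarrow> (vtx \<Rightarrow> complex mat) \<Rightarrow> real" where
  "DQ d k \<rho> = Sup {(1 / real (card (hverts d))) * (\<Sum>x\<in>hverts d. Re (mtrace (\<rho> x * E x))) | E.
                     povm k E (hverts d)}"

definition cprotocol :: "nat \<Rightarrow> nat set \<Rightarrow> (vtx \<Rightarrow> nat \<Rightarrow> real) \<Rightarrow> (vtx \<Rightarrow> nat \<Rightarrow> nat \<Rightarrow> real) \<Rightarrow> bool" where
  "cprotocol d Msg pe pd \<longleftrightarrow> finite Msg \<and>
     (\<forall>x\<in>hverts d. (\<forall>m\<in>Msg. 0 \<le> pe x m) \<and> (\<Sum>m\<in>Msg. pe x m) = 1) \<and>
     (\<forall>y\<in>hverts d. \<forall>m\<in>Msg. (\<forall>z\<in>{1,2}. 0 \<le> pd y m z) \<and> (\<Sum>z\<in>{1::nat,2}. pd y m z) = 1)"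

definition cprob :: "nat set \<Rightarrow> (vtx \<Rightarrow> nat \<Rightarrow> real) \<Rightarrow> (vtx \<Rightarrow> nat \<Rightarrow> nat \<Rightarrow> real) \<Rightarrow> vtx \<Rightarrow> vtx \<Rightarrow> nat \<Rightarrow> real" where
  "cprob Msg pe pd x y z = (\<Sum>m\<in>Msg. pe x m * pd y m z)"

definition DC :: "nat \<Rightarrow> nat set \<Rightarrow> (vtx \<Rightarrow> nat \<Rightarrow> real) \<Rightarrow> real" where
  "DC d Msg pe = (1 / real (card (hverts d))) * (\<Sum>m\<in>Msg. Max ((\<lambda>x. pe x m) ` hverts d))"

end

theory Submission
  imports Defs
begin

text \<open>
  Quantum side: \<open>x\<close> is encoded in the pure state with amplitudes \<open>(-1)^(x ! i) / sqrt d\<close>. Adjacent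
  vertices give orthogonal states, and \<open>tr (\<rho> E) \<le> tr E\<close> bounds the distinguishability by \<open>d / 2^d\<close>.
  Classical side: in a perfect protocol the senders of a fixed message form an independent set of the
  Hadamard graph, so the distinguishability is at least the inverse of the independence number.

  It remains to show that an independent set has at most \<open>(2 / 1.005)^d\<close> elements. Let \<open>F\<close>, \<open>G\<close> be sets of
  words avoiding a progression of \<open>m\<close> mutual distances of step \<open>2\<close>, and strip two coordinates. Taking
  the intersection of the fibers over \<open>ab\<close> and its complement on one side and their union on the other
  lengthens the progression by one. Taking the union over \<open>00, 11\<close> on one side and over \<open>01, 10\<close> on
  the other keeps \<open>m\<close>. Single fibers keep \<open>m\<close> as well, but move the centre \<open>e\<close> of the progression by one.
  One of these choices increases the potential (density of \<open>F\<close>) (density of \<open>G\<close>) \<open>2^(m - \<bar>e\<bar>)\<close> by a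
  factor of at least \<open>16/15\<close>, which makes the densities exponentially small.
\<close>

subsection \<open>Hamming distance and fibers\<close>

text \<open>Integer-valued, because distances enter below through signed offsets from a
  centre.\<close>

definition hdist :: "vtx \<Rightarrow> vtx \<Rightarrow> int" where
  "hdist x y = (\<Sum>i<length x. of_bool (x ! i \<noteq> y ! i))"

lemma hdist_Nil [simp]: "hdist [] y = 0"
  by (simp add: hdist_def)

lemma hdist_Cons [simp]: "hdist (a # x) (b # y) = of_bool (a \<noteq> b) + hdist x y"
  by (simp only: hdist_def length_Cons sum.lessThan_Suc_shift nth_Cons_0 nth_Cons_Suc)

lemma hdist_commute: "length x = length y \<Longrightarrow> hdist x y = hdist y x"
  by (induction rule: list_induct2) auto

lemma card_differing: "length x = d \<Longrightarrow> int (card {i. i < d \<and> x ! i \<noteq> y ! i}) = hdist x y"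
proof -
  assume "length x = d"
  then have "hdist x y = (\<Sum>i\<in>{i\<in>{..<d}. x ! i \<noteq> y ! i}. 1)"
    by (subst sum.inter_filter) (auto simp: hdist_def of_bool_def intro!: sum.cong)
  also have "{i\<in>{..<d}. x ! i \<noteq> y ! i} = {i. i < d \<and> x ! i \<noteq> y ! i}" by auto
  finally show ?thesis by simp
qed

text \<open>With only two letters, each coordinate contributes 0 or 2 to the sum of the three
  distances. It follows that all distances within one weight-parity class are even.\<close>

lemma even_hdist_triangle:
  assumes "length x = length y" "length y = length z"
  shows "even (hdist x y + hdist x z + hdist y z)"
  using assms by (induction rule: list_induct3) auto

lemma finite_hverts [simp]: "finite (hverts d)"
  using finite_lists_length_eq[of "UNIV :: bool set" d] by (simp add: hverts_def)

lemma card_hverts: "card (hverts d) = 2 ^ d"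
  using card_lists_length_eq[of "UNIV :: bool set" d] by (simp add: hverts_def)

definition fiber :: "bool \<Rightarrow> bool \<Rightarrow> vtx set \<Rightarrow> vtx set" where
  "fiber a b F = {x. a # b # x \<in> F}"

lemma fiber_hverts: "F \<subseteq> hverts (2 * Suc k) \<Longrightarrow> fiber a b F \<subseteq> hverts (2 * k)"
  by (auto simp: fiber_def hverts_def)

lemma card_fibers:
  assumes "F \<subseteq> hverts (2 * Suc k)"
  shows "card F = card (fiber False False F) + card (fiber True True F)
    + (card (fiber False True F) + card (fiber True False F))"
proof -
  let ?C = "\<lambda>a b. (\<lambda>x. a # b # x) ` fiber a b F"
  have fin: "finite (fiber a b F)" for a b
    by (rule finite_subset[OF fiber_hverts[OF assms] finite_hverts])
  have card: "card (?C a b) = card (fiber a b F)" for a b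
    by (rule card_image) (simp add: inj_on_def)
  have "F = (?C False False \<union> ?C True True) \<union> (?C False True \<union> ?C True False)"
  proof (intro equalityI subsetI)
    fix x assume x: "x \<in> F"
    then have "length x = Suc (Suc (2 * k))" using assms by (auto simp: hverts_def)
    then obtain a b y where y: "x = a # b # y" by (auto simp: length_Suc_conv)
    then have "x \<in> ?C a b" using x by (simp add: fiber_def)
    then show "x \<in> (?C False False \<union> ?C True True) \<union> (?C False True \<union> ?C True False)"
      by (cases a; cases b) auto
  qed (auto simp: fiber_def)
  also have "card \<dots> = card (?C False False \<union> ?C True True) + card (?C False True \<union> ?C True False)"
    by (rule card_Un_disjoint) (auto simp: fin)
  also have "card (?C False False \<union> ?C True True) = card (?C False False) + card (?C True True)"
    by (rule card_Un_disjoint) (auto simp: fin)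
  also have "card (?C False True \<union> ?C True False) = card (?C False True) + card (?C True False)"
    by (rule card_Un_disjoint) (auto simp: fin)
  finally show ?thesis by (simp add: card)
qed

subsection \<open>Avoiding a progression of distances\<close>

text \<open>Written as \<open>hdist x y - k\<close>, a distance between words of length \<open>2 k\<close> changes by \<open>-1\<close>,
  \<open>0\<close> or \<open>1\<close> for each pair of coordinates. The forbidden set is the arithmetic progression of
  \<open>m\<close> distances with step \<open>2\<close> centred at \<open>k + e\<close>; the parity condition says that only distances of
  the parity of that progression occur at all.\<close>

definition avoiding :: "nat \<Rightarrow> int \<Rightarrow> nat \<Rightarrow> vtx set \<Rightarrow> vtx set \<Rightarrow> bool" where
  "avoiding k e m F G \<longleftrightarrow> F \<subseteq> hverts (2 * k) \<and> G \<subseteq> hverts (2 * k) \<and>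
     (\<forall>x\<in>F. \<forall>y\<in>G. int m < \<bar>hdist x y - int k - e\<bar> \<and> odd (hdist x y - int k - e + int m))"

lemma avoiding_commute: "avoiding k e m F G \<Longrightarrow> avoiding k e m G F"
  unfolding avoiding_def by (metis (mono_tags, lifting) hdist_commute hverts_def mem_Collect_eq subsetD)

text \<open>A word of the intersection has two extensions, which add 0 and 2 to the distance from a
  fixed extension of \<open>y\<close>. The offset \<open>D\<close> of the stripped pair therefore
  lies midway between two admissible offsets.\<close>

lemma avoiding_widen:
  assumes "avoiding (Suc k) e m F G" "m \<ge> 1"
  shows "avoiding k e (Suc m) (fiber a b F \<inter> fiber (\<not> a) (\<not> b) F) (fiber a b G \<union> fiber (\<not> a) (\<not> b) G)"
  unfolding avoiding_def
proof (intro conjI ballI)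
  fix x y
  assume x: "x \<in> fiber a b F \<inter> fiber (\<not> a) (\<not> b) F" and y: "y \<in> fiber a b G \<union> fiber (\<not> a) (\<not> b) G"
  define D where "D = hdist x y - int k - e"
  have *: "int m < \<bar>hdist u v - int (Suc k) - e\<bar> \<and> odd (hdist u v - int (Suc k) - e + int m)"
    if "u \<in> F" "v \<in> G" for u v
    using assms(1) that by (auto simp: avoiding_def)
  obtain c d where c: "c # d # y \<in> G" "c = a \<and> d = b \<or> c = (\<not> a) \<and> d = (\<not> b)"
    using y by (auto simp: fiber_def)
  let ?D = "\<lambda>u. hdist u (c # d # y) - int (Suc k) - e"
  have "?D (a # b # x) = D - 1 \<and> ?D ((\<not> a) # (\<not> b) # x) = D + 1 \<or>
      ?D (a # b # x) = D + 1 \<and> ?D ((\<not> a) # (\<not> b) # x) = D - 1"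
    using c(2) by (elim disjE conjE) (simp_all add: D_def)
  moreover have "a # b # x \<in> F" "(\<not> a) # (\<not> b) # x \<in> F" using x by (auto simp: fiber_def)
  ultimately have "int m < \<bar>D - 1\<bar> \<and> odd (D - 1 + int m)" "int m < \<bar>D + 1\<bar> \<and> odd (D + 1 + int m)"
    using *[OF _ c(1)] by metis+
  \<comment> \<open>As \<open>m\<close> is at least 1, \<open>D - 1\<close> and \<open>D + 1\<close>
    cannot lie on opposite sides of the excluded range, so \<open>D\<close> itself is one step
    further out.\<close>
  then show "int (Suc m) < \<bar>hdist x y - int k - e\<bar>" "odd (hdist x y - int k - e + int (Suc m))"
    using assms(2) unfolding D_def[symmetric] by (simp_all, presburger+)
qed (use assms fiber_hverts in \<open>unfold avoiding_def, blast\<close>)+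

text \<open>The removed pairs of bits always differ in exactly one place. This 1 cancels against the
  drop of the middle distance from \<open>k + 1\<close> to \<open>k\<close>.\<close>

lemma avoiding_keep:
  assumes "avoiding (Suc k) e m F G"
  shows "avoiding k e m (fiber a b F \<union> fiber (\<not> a) (\<not> b) F) (fiber a (\<not> b) G \<union> fiber (\<not> a) b G)"
  unfolding avoiding_def
proof (intro conjI ballI)
  fix x y
  assume x: "x \<in> fiber a b F \<union> fiber (\<not> a) (\<not> b) F" and y: "y \<in> fiber a (\<not> b) G \<union> fiber (\<not> a) b G"
  have *: "int m < \<bar>hdist u v - int (Suc k) - e\<bar> \<and> odd (hdist u v - int (Suc k) - e + int m)"
    if "u \<in> F" "v \<in> G" for u v
    using assms(1) that by (auto simp: avoiding_def)
  obtain p q where p: "p # q # x \<in> F" "p = a \<and> q = b \<or> p = (\<not> a) \<and> q = (\<not> b)"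
    using x by (auto simp: fiber_def)
  obtain c d where c: "c # d # y \<in> G" "c = a \<and> d = (\<not> b) \<or> c = (\<not> a) \<and> d = b"
    using y by (auto simp: fiber_def)
  have "hdist (p # q # x) (c # d # y) = 1 + hdist x y"
    using p(2) c(2) by auto
  with *[OF p(1) c(1)]
  show "int m < \<bar>hdist x y - int k - e\<bar>" "odd (hdist x y - int k - e + int m)"
    by (simp_all only: of_nat_Suc) (simp_all add: algebra_simps)
qed (use assms fiber_hverts in \<open>unfold avoiding_def, blast\<close>)+

lemma avoiding_shift:
  assumes "avoiding (Suc k) e m F G" "c = a \<and> d = b \<or> c = (\<not> a) \<and> d = (\<not> b)"
  shows "\<exists>e'. \<bar>e'\<bar> \<le> \<bar>e\<bar> + 1 \<and> avoiding k e' m (fiber a b F) (fiber c d G)"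
proof (intro exI conjI)
  \<comment> \<open>Equal leading pairs add 0 to the distance and opposite ones add 2, while the
    middle distance drops by 1. Under the assumption on \<open>c\<close> and \<open>d\<close>,
    \<open>c = a\<close> alone tells the two cases apart.\<close>
  define e' where "e' = (if c = a then e + 1 else e - 1)"
  show "\<bar>e'\<bar> \<le> \<bar>e\<bar> + 1" by (auto simp: e'_def)
  have *: "int m < \<bar>hdist u v - int (Suc k) - e\<bar> \<and> odd (hdist u v - int (Suc k) - e + int m)"
    if "u \<in> F" "v \<in> G" for u v
    using assms(1) that by (auto simp: avoiding_def)
  show "avoiding k e' m (fiber a b F) (fiber c d G)"
    unfolding avoiding_def
  proof (intro conjI ballI)
    fix x y assume "x \<in> fiber a b F" "y \<in> fiber c d G"
    then have "a # b # x \<in> F" "c # d # y \<in> G" by (auto simp: fiber_def)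
    from *[OF this] have "int m < \<bar>hdist x y - int k - e'\<bar> \<and> odd (hdist x y - int k - e' + int m)"
      using assms(2) by (auto simp: e'_def algebra_simps)
    then show "int m < \<bar>hdist x y - int k - e'\<bar>" "odd (hdist x y - int k - e' + int m)" by auto
  qed (use assms fiber_hverts in \<open>unfold avoiding_def, blast\<close>)+
qed

section \<open>Real inequalities behind one step of the recursion\<close>

text \<open>For the overlap ratios a = i/s and b = j/t the hypotheses give a(1 - b) < 1/7 and (1 -
  a)b < 1/7. The larger ratio u is at most 1/2 and satisfies u(1 - u) < 1/7 < 4/25 = (1/5)(4/5),
  hence u < 1/5.\<close>

lemma small_overlap:
  fixes s t i j B :: real
  assumes "0 \<le> B" "0 \<le> i" "2 * i \<le> s" "0 \<le> j" "2 * j \<le> t"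
    and "7 * B < 2 * (s * t)" "2 * (i * (t - j)) \<le> B" "2 * ((s - i) * j) \<le> B"
  shows "5 * i < s \<and> 5 * j < t"
proof -
  have "0 \<le> s" "0 \<le> t" "s * t \<noteq> 0" using assms by auto
  then have st: "s > 0" "t > 0" by auto
  define a b where "a = i / s" and "b = j / t"
  have i: "i = a * s" and j: "j = b * t" using st by (auto simp: a_def b_def)
  have ab: "0 \<le> a" "0 \<le> b" "a \<le> 1/2" "b \<le> 1/2"
    using assms st by (auto simp: a_def b_def field_simps)
  have z: "0 < s * t" using st by simp
  have 1: "2 * (a * (1 - b)) * (s * t) \<le> B" and 2: "2 * ((1 - a) * b) * (s * t) \<le> B"
    using assms unfolding i j by (auto simp: algebra_simps)
  have "(7 * (2 * (a * (1 - b))) - 2) * (s * t) < 0" "(7 * (2 * ((1 - a) * b)) - 2) * (s * t) < 0"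
    using 1 2 assms(6) unfolding left_diff_distrib by linarith+
  moreover have "u < 0" if "u * (s * t) < 0" for u
    using that z mult_less_cancel_right_pos[of "s * t" u 0] by simp
  ultimately have "7 * (2 * (a * (1 - b))) - 2 < 0" "7 * (2 * ((1 - a) * b)) - 2 < 0"
    by blast+
  then have 3: "7 * (a * (1 - b)) < 1" "7 * ((1 - a) * b) < 1"
    by linarith+
  have quad: "u < 1/5" if "0 \<le> v" "v \<le> u" "u \<le> 1/2" "7 * (u * (1 - v)) < 1" for u v :: real
  proof (rule ccontr)
    assume "\<not> u < 1/5"
    then have "0 \<le> (u - 1/5) * (4/5 - u)" using that by simp
    also have "\<dots> = u * (1 - u) - 4/25" by (simp add: field_simps)
    finally have "4/25 \<le> u * (1 - u)" by simp
    moreover have "u * (1 - v) \<ge> u * (1 - u)" using that by (intro mult_left_mono) auto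
    ultimately show False using that(4) by linarith
  qed
  have "a < 1/5 \<and> b < 1/5"
  proof (cases "b \<le> a")
    case True then show ?thesis using quad[of b a] ab 3 by simp
  next
    case False then show ?thesis using quad[of a b] ab 3 by (simp add: mult.commute)
  qed
  then show ?thesis using st by (simp add: i j)
qed

text \<open>The variables are the sizes in one step of the recursion: \<open>s0\<close> counts the words of \<open>F\<close> whose first
  two bits agree, \<open>s1\<close> those whose first two bits differ, and \<open>i0\<close>, \<open>i1\<close> are the sizes of the
  intersections of the two fibers concerned; likewise \<open>t\<close> and \<open>j\<close> for \<open>G\<close>.\<close>

lemma fiber_inequality:
  fixes s0 s1 t0 t1 i0 i1 j0 j1 B :: real
  assumes B: "0 \<le> B"
    and i: "0 \<le> i0" "2 * i0 \<le> s0" "0 \<le> i1" "2 * i1 \<le> s1"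
    and j: "0 \<le> j0" "2 * j0 \<le> t0" "0 \<le> j1" "2 * j1 \<le> t1"
    and shift: "s0 * t0 \<le> 8 * B" "s1 * t1 \<le> 8 * B"
    and keep: "(s0 - i0) * (t1 - j1) \<le> B" "(s1 - i1) * (t0 - j0) \<le> B"
    and widen: "2 * (i0 * (t0 - j0)) \<le> B" "2 * ((s0 - i0) * j0) \<le> B"
      "2 * (i1 * (t1 - j1)) \<le> B" "2 * ((s1 - i1) * j1) \<le> B"
  shows "(s0 + s1) * (t0 + t1) \<le> 15 * B"
proof (rule ccontr)
  assume "\<not> ?thesis"
  then have big: "15 * B < s0 * t0 + s0 * t1 + s1 * t0 + s1 * t1" by (simp add: algebra_simps)
  \<comment> \<open>A union of two fibers has at least half of their total size. If the overlap is
    below one fifth of the total, it has at least four fifths, which improves 4 to 5/2.\<close>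
  have half: "s * t \<le> 4 * B" if "2 * i \<le> s" "2 * j \<le> t" "(s - i) * (t - j) \<le> B" "0 \<le> i" "0 \<le> j"
    for s t i j :: real
  proof -
    have "(s / 2) * (t / 2) \<le> (s - i) * (t - j)" using that by (intro mult_mono) auto
    then show ?thesis using that by simp
  qed
  have fifth: "s * t \<le> 5 / 2 * B" if "5 * i < s" "2 * j \<le> t" "(s - i) * (t - j) \<le> B" "0 \<le> i" "0 \<le> j"
    for s t i j :: real
  proof -
    have "(4 / 5 * s) * (t / 2) \<le> (s - i) * (t - j)" using that by (intro mult_mono) auto
    then show ?thesis using that by simp
  qed
  have xy: "s0 * t1 \<le> 4 * B" "s1 * t0 \<le> 4 * B"
    using half i j keep by blast+
  \<comment> \<open>The constant 15 is 4 + 4 + 7/2 + 7/2: with both cross products at most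
    \<open>4 * B\<close>, some diagonal product exceeds 7/2 times \<open>B\<close>. Its index has
    small overlaps on both sides, and each cross product involves one of them.\<close>
  have "7 * B < 2 * (s0 * t0) \<or> 7 * B < 2 * (s1 * t1)" using big xy by linarith
  then have xy': "s0 * t1 \<le> 5/2 * B" "s1 * t0 \<le> 5/2 * B"
  proof (atomize (full), elim disjE)
    assume "7 * B < 2 * (s0 * t0)"
    then have "5 * i0 < s0" "5 * j0 < t0" using small_overlap B i j widen by blast+
    then show "s0 * t1 \<le> 5/2 * B \<and> s1 * t0 \<le> 5/2 * B"
      using fifth[of i0 s0 j1 t1] fifth[of j0 t0 i1 s1] i j keep
      by (simp add: mult.commute[of t0] mult.commute[of "t0 - j0"])
  next
    assume "7 * B < 2 * (s1 * t1)"
    then have "5 * i1 < s1" "5 * j1 < t1" using small_overlap B i j widen by blast+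
    then show "s0 * t1 \<le> 5/2 * B \<and> s1 * t0 \<le> 5/2 * B"
      using fifth[of i1 s1 j0 t0] fifth[of j1 t1 i0 s0] i j keep
      by (simp add: mult.commute[of t1] mult.commute[of "t1 - j1"])
  qed
  have zw: "10 * B < s0 * t0 + s1 * t1" using big xy' by linarith
  \<comment> \<open>The diagonal products sum to more than \<open>10 * B\<close> and each is at most
    \<open>8 * B\<close>, so both exceed \<open>2 * B\<close>. Expanding gives a product of at least
    20 - 4 = 16 times \<open>B * B\<close>.\<close>
  have "(s0 * t0 - 2 * B) * (s1 * t1 - 2 * B) \<ge> 0" using zw shift by (intro mult_nonneg_nonneg) auto
  then have "16 * B * B \<le> (s0 * t0) * (s1 * t1)"
    using mult_left_mono[OF less_imp_le[OF zw], of "2 * B"] B by (simp add: algebra_simps)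
  \<comment> \<open>The diagonal and the cross products multiply to the same number, and the cross
    bound allows only 25/4 times \<open>B * B\<close>.\<close>
  also have "\<dots> = (s0 * t1) * (s1 * t0)" by simp
  also have "\<dots> \<le> (5/2 * B) * (5/2 * B)" by (rule mult_mono) (use xy' i j B in auto)
  finally have "B * B \<le> 0" by simp
  then have "B = 0" by (auto simp: mult_le_0_iff)
  then show False using zw shift by simp
qed

section \<open>The recursive size bound\<close>

text \<open>Distances from one word of the other set have a fixed parity, so each set holds at most
  two of the four words. An offset of absolute value at most 1 escapes the excluded range only if
  \<open>m\<close> is at most the absolute value of \<open>e\<close>.\<close>

lemma avoiding_base:
  assumes "avoiding 1 e m F G"
  shows "real (card F) * real (card G) * 2 ^ m \<le> 4 * 2 ^ nat \<bar>e\<bar>"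
proof (cases "F = {} \<or> G = {}")
  case False
  then obtain x y where xy: "x \<in> F" "y \<in> G" by blast
  have len: "length u = 2" if "u \<in> F \<union> G" for u
    using assms that by (auto simp: avoiding_def hverts_def)
  have av: "int m < \<bar>hdist u v - 1 - e\<bar> \<and> odd (hdist u v - 1 - e + int m)"
    if "u \<in> F" "v \<in> G" for u v
    using assms that by (auto simp: avoiding_def)
  have two: "\<exists>a b. u = [a, b]" if "u \<in> F \<union> G" for u
    using len[OF that] by (auto simp: length_Suc_conv numeral_2_eq_2)
  have par: "card H \<le> 2"
    if H: "\<And>u. u \<in> H \<Longrightarrow> length u = 2" "\<And>u. u \<in> H \<Longrightarrow> even (hdist u z) = p" and "length z = 2"
    for H :: "vtx set" and z p
  proof -
    obtain c d where z: "z = [c, d]" using \<open>length z = 2\<close> by (auto simp: length_Suc_conv numeral_2_eq_2)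
    \<comment> \<open>\<open>q\<close> is the common truth value of "the two bits agree" for the
      words of \<open>H\<close>.\<close>
    define q where "q = (p = (c = d))"
    have "H \<subseteq> {[False, \<not> q], [True, q]}"
    proof
      fix u assume u: "u \<in> H"
      then obtain a b where ab: "u = [a, b]" using H(1) by (fastforce simp: length_Suc_conv numeral_2_eq_2)
      show "u \<in> {[False, \<not> q], [True, q]}"
        using H(2)[OF u] by (cases a; cases b; cases c; cases d) (auto simp: ab z q_def)
    qed
    then have "card H \<le> card {[False, \<not> q], [True, q]}" by (intro card_mono) auto
    then show ?thesis by simp
  qed
  have "card F \<le> 2"
    by (rule par[of F y "odd (1 + e + int m)"]) (use xy av len in \<open>auto\<close>)
  moreover have "card G \<le> 2"
  proof (rule par)
    show "even (hdist u x) = odd (1 + e + int m)" if "u \<in> G" for u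
      using av[OF xy(1) that] hdist_commute[of u x] len xy(1) that by auto
  qed (use xy len in auto)
  ultimately have "real (card F) * real (card G) \<le> 2 * 2"
    by (intro mult_mono) auto
  moreover have "m \<le> nat \<bar>e\<bar>"
  proof -
    obtain a b where "x = [a, b]" using two[of x] xy by auto
    moreover obtain c d where "y = [c, d]" using two[of y] xy by auto
    ultimately have "\<bar>hdist x y - 1\<bar> \<le> 1" by (auto simp: of_bool_def)
    then show ?thesis using av[OF xy] by linarith
  qed
  ultimately show ?thesis by (intro mult_mono[OF _ power_increasing]) auto
qed auto

text \<open>Each stripped pair of coordinates divides the number of pairs of words by 16, but the
  bound only by 15. The gain of 16/15 per step makes the product of densities decay.\<close>

lemma avoiding_bound:
  assumes "avoiding (Suc k) e m F G" "m \<ge> 1"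
  shows "real (card F) * real (card G) * 2 ^ m \<le> 4 * 15 ^ k * 2 ^ nat \<bar>e\<bar>"
  using assms
proof (induction k arbitrary: e m F G)
  case 0
  then show ?case using avoiding_base by simp
next
  case (Suc k)
  note av = Suc.prems(1)
  have FG: "F \<subseteq> hverts (2 * Suc (Suc k))" "G \<subseteq> hverts (2 * Suc (Suc k))"
    using av by (auto simp: avoiding_def)
  \<comment> \<open>\<open>B\<close> is the inductive bound with unchanged \<open>e\<close> and
    \<open>m\<close>. Keeping gives \<open>B\<close>, widening gives half of it, and a shift of the
    centre at most doubles it.\<close>
  define B where "B = 4 * 15 ^ k * 2 ^ nat \<bar>e\<bar> / (2 ^ m :: real)"
  have fin: "finite (fiber a b F)" "finite (fiber a b G)" for a b
    by (rule finite_subset[OF fiber_hverts[OF FG(1)] finite_hverts],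
        rule finite_subset[OF fiber_hverts[OF FG(2)] finite_hverts])
  define f g where "f = (\<lambda>a b. real (card (fiber a b F)))" and "g = (\<lambda>a b. real (card (fiber a b G)))"
  define i j where "i = (\<lambda>b. real (card (fiber False b F \<inter> fiber True (\<not> b) F)))"
    and "j = (\<lambda>b. real (card (fiber False b G \<inter> fiber True (\<not> b) G)))"
  have Un: "real (card (fiber False b F \<union> fiber True (\<not> b) F)) = f False b + f True (\<not> b) - i b"
    "real (card (fiber False b G \<union> fiber True (\<not> b) G)) = g False b + g True (\<not> b) - j b" for b
    using card_Un_Int[OF fin(1) fin(1)] card_Un_Int[OF fin(2) fin(2)]
    by (simp_all add: f_def g_def i_def j_def flip: of_nat_add)
  have le: "i b \<le> f False b" "i b \<le> f True (\<not> b)" "j b \<le> g False b" "j b \<le> g True (\<not> b)" for b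
    unfolding i_def j_def f_def g_def by (simp_all add: card_mono fin)
  have ij: "0 \<le> i b" "2 * i b \<le> f False b + f True (\<not> b)"
    "0 \<le> j b" "2 * j b \<le> g False b + g True (\<not> b)" for b
    using le[of b] by (simp_all only: i_def j_def of_nat_0_le_iff)
  have step: "u * v \<le> B" if "u * v * 2 ^ m \<le> 4 * 15 ^ k * 2 ^ nat \<bar>e\<bar>" for u v
    using that by (simp add: B_def pos_le_divide_eq)
  have step': "2 * (u * v) \<le> B" if "u * v * 2 ^ Suc m \<le> 4 * 15 ^ k * 2 ^ nat \<bar>e\<bar>" for u v
    using that by (simp add: B_def pos_le_divide_eq mult_ac)
  have keep: "(f False b + f True (\<not> b) - i b) * (g False (\<not> b) + g True b - j (\<not> b)) \<le> B" for b
    using step[OF Suc.IH[OF avoiding_keep[OF av, of False b] Suc.prems(2)]] Un(1)[of b] Un(2)[of "\<not> b"]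
    by simp
  have widen1: "2 * (i b * (g False b + g True (\<not> b) - j b)) \<le> B" for b
    using step'[OF Suc.IH[OF avoiding_widen[OF av Suc.prems(2), of False b]]] Un(2)[of b]
    by (simp add: i_def)
  have widen2: "2 * ((f False b + f True (\<not> b) - i b) * j b) \<le> B" for b
    using step'[OF Suc.IH[OF avoiding_widen[OF avoiding_commute[OF av] Suc.prems(2), of False b]]] Un(1)[of b]
    by (simp add: j_def mult.commute)
  have shift: "f a b * g c d \<le> 2 * B" if cd: "c = a \<and> d = b \<or> c = (\<not> a) \<and> d = (\<not> b)" for a b c d
  proof -
    obtain e' where e': "\<bar>e'\<bar> \<le> \<bar>e\<bar> + 1" "avoiding (Suc k) e' m (fiber a b F) (fiber c d G)"
      using avoiding_shift[OF av cd] by blast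
    have "f a b * g c d * 2 ^ m \<le> 4 * 15 ^ k * 2 ^ nat \<bar>e'\<bar>"
      unfolding f_def g_def using Suc.IH[OF e'(2) Suc.prems(2)] .
    also have "\<dots> \<le> 4 * 15 ^ k * 2 ^ Suc (nat \<bar>e\<bar>)"
      using e'(1) by (intro mult_left_mono power_increasing) auto
    finally show ?thesis by (simp add: B_def field_simps)
  qed
  have "(f False False + f True True + (f False True + f True False)) *
      (g False False + g True True + (g False True + g True False)) \<le> 15 * B"
  proof (rule fiber_inequality[where ?i0.0 = "i False" and ?i1.0 = "i True"
        and ?j0.0 = "j False" and ?j1.0 = "j True"])
    show "0 \<le> B" by (simp add: B_def)
    show "(f False False + f True True) * (g False False + g True True) \<le> 8 * B"
      using shift[where a = False and b = False and c = False and d = False]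
        shift[where a = False and b = False and c = True and d = True]
        shift[where a = True and b = True and c = False and d = False]
        shift[where a = True and b = True and c = True and d = True]
      by (simp add: algebra_simps)
    show "(f False True + f True False) * (g False True + g True False) \<le> 8 * B"
      using shift[where a = False and b = True and c = False and d = True]
        shift[where a = False and b = True and c = True and d = False]
        shift[where a = True and b = False and c = False and d = True]
        shift[where a = True and b = False and c = True and d = False]
      by (simp add: algebra_simps)
  qed (use ij[of False] ij[of True] keep[of False] keep[of True] widen1[of False] widen1[of True]
      widen2[of False] widen2[of True] in auto)
  then have "real (card F) * real (card G) \<le> 15 * B"
    using card_fibers[OF FG(1)] card_fibers[OF FG(2)] by (simp add: f_def g_def)
  then show ?case by (simp add: B_def field_simps)
qed

subsection \<open>Independent sets and classical protocols\<close>

definition hindep :: "nat \<Rightarrow> vtx set \<Rightarrow> bool" where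
  "hindep d A \<longleftrightarrow> A \<subseteq> hverts d \<and> (\<forall>x\<in>A. \<forall>y\<in>A. \<not> hadj d x y)"

text \<open>Within a weight-parity class all distances are even, and so is \<open>d div 2\<close>
  because 4 divides \<open>d\<close>. Independence thus excludes a progression of length 1 centred
  at \<open>d div 2\<close>, and the recursion applies to each class paired with itself.\<close>

lemma card_independent:
  assumes "0 < d" "4 dvd d" "hindep d A"
  shows "real (card A) * 1.005 ^ d \<le> 2 ^ d"
proof -
  obtain q where q: "d = 4 * q" "0 < q" using assms by (auto elim!: dvdE)
  define k where "k = 2 * q - 1"
  have d: "d = 2 * Suc k" "even (Suc k)" using q by (auto simp: k_def)
  define E where "E = (\<lambda>p. {x \<in> A. even (hdist x (replicate d False)) = p})"
  have AE: "A = E True \<union> E False" by (auto simp: E_def)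
  have Ad: "length x = d" if "x \<in> A" for x
    using assms(3) that by (auto simp: hindep_def hverts_def)
  have "avoiding (Suc k) 0 1 (E p) (E p)" for p
    unfolding avoiding_def
  proof (intro conjI ballI)
    fix x y assume x: "x \<in> E p" and y: "y \<in> E p"
    have xy: "x \<in> A" "y \<in> A" using x y by (auto simp: E_def)
    have "even (hdist x y)"
      using even_hdist_triangle[of x y "replicate d False"] Ad[OF xy(1)] Ad[OF xy(2)] x y
      by (auto simp: E_def)
    moreover have "hdist x y \<noteq> int (Suc k)"
    proof
      assume "hdist x y = int (Suc k)"
      then have "card {i. i < d \<and> x ! i \<noteq> y ! i} = d div 2"
        using card_differing[OF Ad[OF xy(1)], of y] d by simp
      then have "hadj d x y" using xy Ad by (simp add: hadj_def hverts_def)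
      then show False using assms(3) xy by (simp add: hindep_def)
    qed
    ultimately show "int 1 < \<bar>hdist x y - int (Suc k) - 0\<bar>"
      "odd (hdist x y - int (Suc k) - 0 + int 1)"
      using d(2) by (simp_all, presburger+)
  qed (use Ad d in \<open>auto simp: E_def hverts_def\<close>)
  from avoiding_bound[OF this] have E: "(real (card (E p)))\<^sup>2 \<le> 2 * 15 ^ k" for p
    by (simp add: power2_eq_square)
  have "real (card A) \<le> real (card (E True)) + real (card (E False))"
    using card_Un_le[of "E True" "E False"] AE by simp
  then have "(real (card A))\<^sup>2 \<le> (real (card (E True)) + real (card (E False)))\<^sup>2"
    by (intro power_mono) auto
  also have "\<dots> \<le> 2 * ((real (card (E True)))\<^sup>2 + (real (card (E False)))\<^sup>2)"
    using sum_squares_bound[of "real (card (E True))" "real (card (E False))"]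
    by (simp add: power2_sum)
  also have "\<dots> \<le> 8 * 15 ^ k" using E[of True] E[of False] by simp
  finally have A: "(real (card A))\<^sup>2 \<le> 8 * 15 ^ k" .
  \<comment> \<open>Squaring turns the exponent into \<open>2 * d = 4 * Suc k\<close>, and the
    fourth power of 1.005 is below 16/15.\<close>
  have "(real (card A) * 1.005 ^ d)\<^sup>2 = (real (card A))\<^sup>2 * ((1.005::real) ^ 4) ^ Suc k"
    by (simp only: d(1) power_mult_distrib flip: power_mult) (simp only: mult_ac, simp)
  also have "\<dots> \<le> (8 * 15 ^ k) * (16 / 15) ^ Suc k"
    using A by (intro mult_mono power_mono) (auto simp: power_divide)
  also have "\<dots> = 8 * 16 / 15 * 16 ^ k" by (simp add: power_divide)
  also have "\<dots> \<le> 16 * 16 ^ k" by (intro mult_right_mono) auto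
  also have "\<dots> = ((2::real) ^ d)\<^sup>2" using d by (simp add: power_mult[symmetric] power_add) (simp add: power_mult)
  finally show ?thesis by (rule power2_le_imp_le) simp
qed

section \<open>Perfect success as vanishing total loss\<close>

text \<open>The normalising factor counts exactly the probabilities in the sum, so the deficit from
  1 is an average of individual failures.\<close>

lemma success_eq:
  "success d p = 1 - (\<Sum>y\<in>hverts d. (1 - p y y 1) + (\<Sum>x\<in>hnbrs d y. 1 - p x y 2)) /
    (real (\<Sum>x\<in>hverts d. card (hnbrs d x)) + real (card (hverts d)))"
proof -
  let ?T = "real (\<Sum>x\<in>hverts d. card (hnbrs d x)) + real (card (hverts d))"
  let ?S = "\<Sum>y\<in>hverts d. p y y 1 + (\<Sum>x\<in>hnbrs d y. p x y 2)"
  have "(\<Sum>y\<in>hverts d. (1 - p y y 1) + (\<Sum>x\<in>hnbrs d y. 1 - p x y 2)) = ?T - ?S"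
    by (simp add: sum_subtractf sum.distrib)
  moreover have "?T > 0" by (intro add_nonneg_pos of_nat_0_le_iff) (simp add: card_hverts)
  ultimately show ?thesis by (simp add: success_def field_simps)
qed

lemma success_eq_1_iff:
  assumes "\<And>y. y \<in> hverts d \<Longrightarrow> p y y 1 \<le> 1"
    and "\<And>x y. y \<in> hverts d \<Longrightarrow> x \<in> hnbrs d y \<Longrightarrow> p x y 2 \<le> 1"
  shows "success d p = 1 \<longleftrightarrow> (\<forall>y\<in>hverts d. p y y 1 = 1 \<and> (\<forall>x\<in>hnbrs d y. p x y 2 = 1))"
proof -
  have fin: "finite (hnbrs d y)" for y by (simp add: hnbrs_def)
  have T: "real (\<Sum>x\<in>hverts d. card (hnbrs d x)) + real (card (hverts d)) \<noteq> 0"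
    by (simp add: card_hverts add_nonneg_eq_0_iff sum_nonneg)
  have nn: "0 \<le> (\<Sum>x\<in>hnbrs d y. 1 - p x y 2)" if "y \<in> hverts d" for y
    using assms(2)[OF that] by (intro sum_nonneg) simp
  have "success d p = 1 \<longleftrightarrow> (\<Sum>y\<in>hverts d. (1 - p y y 1) + (\<Sum>x\<in>hnbrs d y. 1 - p x y 2)) = 0"
    unfolding success_eq using T by simp
  also have "\<dots> \<longleftrightarrow> (\<forall>y\<in>hverts d. (1 - p y y 1) + (\<Sum>x\<in>hnbrs d y. 1 - p x y 2) = 0)"
    using nn assms(1) by (intro sum_nonneg_eq_0_iff) (auto intro!: add_nonneg_nonneg)
  also have "\<dots> \<longleftrightarrow> (\<forall>y\<in>hverts d. 1 - p y y 1 = 0 \<and> (\<Sum>x\<in>hnbrs d y. 1 - p x y 2) = 0)"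
    using nn assms(1) by (intro ball_cong refl add_nonneg_eq_0_iff) auto
  also have "\<dots> \<longleftrightarrow> (\<forall>y\<in>hverts d. 1 - p y y 1 = 0 \<and> (\<forall>x\<in>hnbrs d y. 1 - p x y 2 = 0))"
    using assms(2) fin by (intro ball_cong refl conj_cong sum_nonneg_eq_0_iff) auto
  finally show ?thesis by auto
qed

text \<open>If adjacent \<open>x\<close> and \<open>y\<close> could both send \<open>m\<close>, then
  Bob holding \<open>y\<close> would have to answer 1 with certainty on \<open>m\<close>, for the
  input pair \<open>y\<close>, \<open>y\<close>, and also 2 with certainty, for the pair
  \<open>x\<close>, \<open>y\<close>.\<close>

lemma classical_support_independent:
  assumes c: "cprotocol d Msg pe pd" and s: "success d (cprob Msg pe pd) = 1" and m: "m \<in> Msg"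
  shows "hindep d {x \<in> hverts d. pe x m > 0}"
proof -
  have fin: "finite Msg" using c by (simp add: cprotocol_def)
  have pe: "0 \<le> pe x n" "(\<Sum>n\<in>Msg. pe x n) = 1" if "x \<in> hverts d" "n \<in> Msg" for x n
    using c that by (auto simp: cprotocol_def)
  have pd: "0 \<le> pd y n 1" "0 \<le> pd y n 2" "pd y n 1 + pd y n 2 = 1"
    if "y \<in> hverts d" "n \<in> Msg" for y n
    using c that by (auto simp: cprotocol_def)
  have eq: "1 - cprob Msg pe pd x y z = (\<Sum>n\<in>Msg. pe x n * (1 - pd y n z))"
    if "x \<in> hverts d" for x y z
    using pe(2)[OF that m] by (simp add: cprob_def right_diff_distrib sum_subtractf)
  have nn: "0 \<le> pe x n * (1 - pd y n z)"
    if "x \<in> hverts d" "y \<in> hverts d" "z \<in> {1, 2}" "n \<in> Msg" for x y z n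
    using pe(1)[of x n] pd[of y n] that by (intro mult_nonneg_nonneg) auto
  have le: "cprob Msg pe pd x y z \<le> 1" if "x \<in> hverts d" "y \<in> hverts d" "z \<in> {1, 2}" for x y z
    using eq[of x y z] sum_nonneg[of Msg "\<lambda>n. pe x n * (1 - pd y n z)"] nn[OF that] that by simp
  have sub: "x \<in> hverts d" if "x \<in> hnbrs d y" for x y
    using that by (simp add: hnbrs_def)
  have one: "cprob Msg pe pd y y 1 = 1" "x \<in> hnbrs d y \<Longrightarrow> cprob Msg pe pd x y 2 = 1"
    if "y \<in> hverts d" for x y
    using success_eq_1_iff[of d "cprob Msg pe pd"] s le sub that by auto
  have sure: "pd y m z = 1"
    if "x \<in> hverts d" "y \<in> hverts d" "z \<in> {1, 2}" "pe x m > 0" "cprob Msg pe pd x y z = 1" for x y z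
  proof -
    have "(\<Sum>n\<in>Msg. pe x n * (1 - pd y n z)) = 0" using eq[of x y z] that by simp
    then have "pe x m * (1 - pd y m z) = 0"
      using sum_nonneg_eq_0_iff[OF fin, of "\<lambda>n. pe x n * (1 - pd y n z)"] nn[OF that(1-3)] m by blast
    then show ?thesis using that by simp
  qed
  show ?thesis unfolding hindep_def
  proof (intro conjI ballI notI)
    fix x y assume x: "x \<in> {x \<in> hverts d. pe x m > 0}" and y: "y \<in> {x \<in> hverts d. pe x m > 0}"
      and adj: "hadj d x y"
    have "cprob Msg pe pd x y 2 = 1" using one(2)[of y x] adj x y by (simp add: hnbrs_def)
    then have "pd y m 2 = 1" using sure[of x y 2] x y by simp
    moreover have "pd y m 1 = 1" using sure[of y y 1] one(1)[of y] y by simp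
    ultimately show False using pd(3)[of y m] y m by simp
  qed auto
qed

text \<open>The probabilities of sending a fixed message sum to at most its maximal probability
  times the size of an independent set. Over all messages these sums total
  \<open>2 ^ d\<close>.\<close>

lemma DC_lower_bound:
  assumes d: "0 < d" "4 dvd d"
    and c: "cprotocol d Msg pe pd" and s: "success d (cprob Msg pe pd) = 1"
  shows "1.005 ^ d \<le> DC d Msg pe * 2 ^ d"
proof -
  let ?mx = "\<lambda>m. Max ((\<lambda>x. pe x m) ` hverts d)"
  have ne: "hverts d \<noteq> {}" using card_hverts[of d] by auto
  have col: "(\<Sum>x\<in>hverts d. pe x m) * 1.005 ^ d \<le> 2 ^ d * ?mx m" if m: "m \<in> Msg" for m
  proof -
    let ?A = "{x \<in> hverts d. pe x m > 0}"
    have le: "pe x m \<le> ?mx m" if "x \<in> hverts d" for x using that by (intro Max_ge) auto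
    obtain x where x: "x \<in> hverts d" using ne by blast
    have "0 \<le> pe x m" using c x m by (simp add: cprotocol_def)
    then have mx: "0 \<le> ?mx m" using le[OF x] by linarith
    have "(\<Sum>x\<in>hverts d. pe x m) = (\<Sum>x\<in>?A. pe x m)"
      using c m by (intro sum.mono_neutral_right) (auto simp: cprotocol_def not_less intro!: antisym)
    also have "\<dots> \<le> real (card ?A) * ?mx m" using le by (intro sum_bounded_above) auto
    finally have "(\<Sum>x\<in>hverts d. pe x m) * 1.005 ^ d \<le> (real (card ?A) * 1.005 ^ d) * ?mx m"
      by (simp add: mult.commute mult.left_commute)
    also have "\<dots> \<le> 2 ^ d * ?mx m"
      using card_independent[OF d classical_support_independent[OF c s m]] mx by (intro mult_right_mono)
    finally show ?thesis .
  qed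
  have "(2::real) ^ d = (\<Sum>x\<in>hverts d. \<Sum>m\<in>Msg. pe x m)"
    using c by (simp add: cprotocol_def card_hverts)
  also have "\<dots> = (\<Sum>m\<in>Msg. \<Sum>x\<in>hverts d. pe x m)" by (rule sum.swap)
  finally have "2 ^ d * 1.005 ^ d = (\<Sum>m\<in>Msg. (\<Sum>x\<in>hverts d. pe x m) * 1.005 ^ d)"
    by (simp add: sum_distrib_right)
  also have "\<dots> \<le> (\<Sum>m\<in>Msg. 2 ^ d * ?mx m)" by (intro sum_mono col)
  also have "\<dots> = 2 ^ d * (DC d Msg pe * 2 ^ d)"
    by (simp add: DC_def card_hverts flip: sum_distrib_left)
  finally show ?thesis by simp
qed

subsection \<open>The quantum protocol\<close>

lemma quadratic_form_eq:
  assumes "A \<in> carrier_mat k k"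
  shows "conjugate (vec k v) \<bullet> (A *\<^sub>v vec k v) = (\<Sum>i<k. \<Sum>j<k. cnj (v i) * A $$ (i, j) * v j)"
  using assms
  by (auto simp: scalar_prod_def sum_distrib_left mult.assoc lessThan_atLeast0 intro!: sum.cong)

lemma psd_iff:
  "psd k A \<longleftrightarrow> A \<in> carrier_mat k k \<and> (\<forall>v. 0 \<le> (\<Sum>i<k. \<Sum>j<k. cnj (v i) * A $$ (i, j) * v j))"
proof -
  have "(\<forall>v\<in>carrier_vec k. 0 \<le> conjugate v \<bullet> (A *\<^sub>v v)) \<longleftrightarrow>
      (\<forall>v. 0 \<le> conjugate (vec k v) \<bullet> (A *\<^sub>v vec k v))"
  proof (intro iffI ballI allI)
    fix v :: "complex vec"
    assume "\<forall>v. 0 \<le> conjugate (vec k v) \<bullet> (A *\<^sub>v vec k v)" "v \<in> carrier_vec k"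
    then show "0 \<le> conjugate v \<bullet> (A *\<^sub>v v)"
      using eq_vecI[of v "vec k (($) v)"] by (metis carrier_vecD dim_vec index_vec)
  qed auto
  then show ?thesis by (auto simp: psd_def quadratic_form_eq)
qed

lemma mtrace_mult:
  assumes "A \<in> carrier_mat k k" "B \<in> carrier_mat k k"
  shows "mtrace (A * B) = (\<Sum>i<k. \<Sum>j<k. A $$ (i, j) * B $$ (j, i))"
  using assms by (auto simp: mtrace_def scalar_prod_def lessThan_atLeast0 intro!: sum.cong)

lemma cnj_mult_self_nonneg: "0 \<le> cnj z * z / of_nat n"
  by (simp add: less_eq_complex_def)

definition vsign :: "vtx \<Rightarrow> nat \<Rightarrow> complex" where
  "vsign x i = (if x ! i then -1 else 1)"

lemma vsign_simps [simp]: "cnj (vsign x i) = vsign x i" "vsign x i * vsign x i = 1"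
  "vsign x i * (vsign x i * z) = z"
  by (simp_all add: vsign_def)

text \<open>For positive \<open>d\<close>, the projector onto a real unit vector with signs
  \<open>vsign x\<close>; the two factors sqrt d merge into \<open>d\<close>.\<close>

definition hstate :: "nat \<Rightarrow> vtx \<Rightarrow> complex mat" where
  "hstate d x = mat d d (\<lambda>(i, j). vsign x i * vsign x j / of_nat d)"

lemma hstate_carrier [simp]: "hstate d x \<in> carrier_mat d d"
  by (simp add: hstate_def)

lemma dim_hstate [simp]: "dim_row (hstate d x) = d" "dim_col (hstate d x) = d"
  by (simp_all add: hstate_def)

lemma hstate_index [simp]:
  "i < d \<Longrightarrow> j < d \<Longrightarrow> hstate d x $$ (i, j) = vsign x i * vsign x j / of_nat d"
  by (simp add: hstate_def)

lemma mtrace_hstate: "0 < d \<Longrightarrow> mtrace (hstate d x) = 1"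
  by (simp add: mtrace_def hstate_def)

lemma hstate_form:
  "(\<Sum>i<d. \<Sum>j<d. cnj (v i) * hstate d x $$ (i, j) * v j) =
    cnj (\<Sum>i<d. vsign x i * v i) * (\<Sum>i<d. vsign x i * v i) / of_nat d"
  by (simp only: cnj_sum sum_product sum_divide_distrib) (auto intro!: sum.cong simp: mult_ac)

lemma psd_hstate: "psd d (hstate d x)"
  unfolding psd_iff hstate_form
  by (intro conjI allI hstate_carrier cnj_mult_self_nonneg)

text \<open>This is Cauchy-Schwarz in the form of Lagrange's identity: the quadratic form is the sum
  of |a_i - a_j|^2 / (2d) over all pairs, where \<open>a\<close> is \<open>v\<close> with the signs
  absorbed.\<close>

lemma psd_one_minus_hstate:
  assumes "0 < d"
  shows "psd d (1\<^sub>m d - hstate d x)"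
  unfolding psd_iff
proof (intro conjI allI)
  fix v :: "nat \<Rightarrow> complex"
  define a where "a = (\<lambda>i. vsign x i * v i)"
  have "(\<Sum>i<d. \<Sum>j<d. cnj (v i) * (1\<^sub>m d - hstate d x) $$ (i, j) * v j) =
      (\<Sum>i<d. \<Sum>j<d. cnj (v i) * 1\<^sub>m d $$ (i, j) * v j) - (\<Sum>i<d. \<Sum>j<d. cnj (v i) * hstate d x $$ (i, j) * v j)"
    unfolding sum_subtractf[symmetric] by (intro sum.cong) (auto simp: algebra_simps)
  also have "(\<Sum>i<d. \<Sum>j<d. cnj (v i) * 1\<^sub>m d $$ (i, j) * v j) = (\<Sum>i<d. \<Sum>j<d. if j = i then cnj (v i) * v i else 0)"
    by (intro sum.cong) auto
  also have "\<dots> = (\<Sum>i<d. cnj (a i) * a i)"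
    by (simp add: a_def mult_ac)
  also have "(\<Sum>i<d. cnj (a i) * a i) - (\<Sum>i<d. \<Sum>j<d. cnj (v i) * hstate d x $$ (i, j) * v j) =
      (\<Sum>i<d. \<Sum>j<d. cnj (a i - a j) * (a i - a j) / of_nat (2 * d))"
  proof -
    have pairs: "(\<Sum>i<d. \<Sum>j<d. cnj (a i - a j) * (a i - a j)) =
        2 * of_nat d * (\<Sum>i<d. cnj (a i) * a i) - 2 * (cnj (\<Sum>i<d. a i) * (\<Sum>i<d. a i))"
      by (simp add: left_diff_distrib right_diff_distrib sum_subtractf sum_product
          mult.commute[of "a _"] flip: sum_distrib_left)
        (simp only: sum_distrib_left, rule sum.swap)
    show ?thesis
      unfolding hstate_form a_def[symmetric] sum_divide_distrib[symmetric] pairs using assms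
      by (simp add: diff_divide_distrib)
  qed
  finally show "0 \<le> (\<Sum>i<d. \<Sum>j<d. cnj (v i) * (1\<^sub>m d - hstate d x) $$ (i, j) * v j)"
    by (simp only:) (intro sum_nonneg cnj_mult_self_nonneg)
qed (rule carrier_matI; simp)

lemma sum_sign_mult:
  "(\<Sum>i<d. vsign x i * vsign y i) = of_nat d - 2 * of_nat (card {i. i < d \<and> x ! i \<noteq> y ! i})"
proof -
  have "(\<Sum>i<d. vsign x i * vsign y i) = (\<Sum>i<d. 1 - 2 * (if x ! i \<noteq> y ! i then 1 else 0))"
    by (intro sum.cong) (auto simp: vsign_def)
  also have "\<dots> = of_nat d - 2 * (\<Sum>i<d. if x ! i \<noteq> y ! i then 1 else 0)"
    by (simp only: sum_subtractf sum_distrib_left) simp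
  also have "(\<Sum>i<d. if x ! i \<noteq> y ! i then 1 else 0 :: complex) = (\<Sum>i\<in>{i \<in> {..<d}. x ! i \<noteq> y ! i}. 1)"
    by (rule sum.inter_filter[symmetric]) simp
  also have "{i \<in> {..<d}. x ! i \<noteq> y ! i} = {i. i < d \<and> x ! i \<noteq> y ! i}" by auto
  finally show ?thesis by simp
qed

lemma mtrace_hstate_mult:
  "mtrace (hstate d x * hstate d y) = (\<Sum>i<d. vsign x i * vsign y i)\<^sup>2 / (of_nat d)\<^sup>2"
  unfolding mtrace_mult[OF hstate_carrier hstate_carrier] power2_eq_square sum_product sum_divide_distrib
  by (intro sum.cong refl) (simp add: mult_ac)

lemma mtrace_hstate_self: "0 < d \<Longrightarrow> mtrace (hstate d x * hstate d x) = 1"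
  by (simp add: mtrace_hstate_mult)

lemma mtrace_hstate_adjacent: "hadj d x y \<Longrightarrow> even d \<Longrightarrow> mtrace (hstate d x * hstate d y) = 0"
  by (auto simp: mtrace_hstate_mult sum_sign_mult hadj_def elim!: evenE)

lemma mtrace_hstate_compl:
  assumes "0 < d"
  shows "mtrace (hstate d x * (1\<^sub>m d - hstate d y)) = 1 - mtrace (hstate d x * hstate d y)"
proof -
  have "mtrace (hstate d x * (1\<^sub>m d - hstate d y)) =
      (\<Sum>i<d. \<Sum>j<d. hstate d x $$ (i, j) * 1\<^sub>m d $$ (j, i)) -
      (\<Sum>i<d. \<Sum>j<d. hstate d x $$ (i, j) * hstate d y $$ (j, i))"
    unfolding sum_subtractf[symmetric]
    by (subst mtrace_mult[of _ d]) (auto simp: right_diff_distrib intro!: sum.cong)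
  also have "(\<Sum>i<d. \<Sum>j<d. hstate d x $$ (i, j) * 1\<^sub>m d $$ (j, i)) =
      (\<Sum>i<d. \<Sum>j<d. if j = i then hstate d x $$ (i, i) else 0)"
    by (intro sum.cong) auto
  also have "\<dots> = 1" using mtrace_hstate[OF assms, of x] by (simp add: mtrace_def)
  finally show ?thesis by (simp add: mtrace_mult[of _ d])
qed

section \<open>Bounds on the quantum distinguishability\<close>

text \<open>Positivity of \<open>E\<close> is tested on the differences of two signed basis vectors.
  Summed over all pairs of indices, the diagonal entries give \<open>2 * d\<close> times the trace
  of \<open>E\<close>, and the mixed ones \<open>2 * d\<close> times the trace of the
  product.\<close>

lemma mtrace_hstate_le:
  assumes E: "psd d E" and d: "0 < d"
  shows "Re (mtrace (hstate d x * E)) \<le> Re (mtrace E)"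
proof -
  have C: "E \<in> carrier_mat d d" using E by (simp add: psd_def)
  let ?s = "vsign x"
  have pair: "0 \<le> Re (E $$ (i, i) + E $$ (j, j) - (?s i * E $$ (i, j) * ?s j + ?s j * E $$ (j, i) * ?s i))"
    if ij: "i < d" "j < d" for i j
  proof -
    define v where "v = (\<lambda>l. (if l = i then ?s i else 0) - (if l = j then ?s j else 0))"
    have delta: "(\<Sum>l<d. f l * v l) = f i * ?s i - f j * ?s j" for f :: "nat \<Rightarrow> complex"
    proof -
      have "f l * v l = (if l = i then f i * ?s i else 0) - (if l = j then f j * ?s j else 0)" for l
        by (simp add: v_def right_diff_distrib)
      then show ?thesis using ij by (simp add: sum_subtractf)
    qed
    have "cnj (v l) = v l" for l by (simp add: v_def)
    moreover have "0 \<le> (\<Sum>a<d. \<Sum>b<d. cnj (v a) * E $$ (a, b) * v b)"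
      using E unfolding psd_iff by blast
    ultimately have "0 \<le> (\<Sum>a<d. (\<Sum>b<d. E $$ (a, b) * v b) * v a)"
      by (simp add: sum_distrib_left sum_distrib_right mult_ac)
    also have "\<dots> = E $$ (i, i) + E $$ (j, j) - (?s i * E $$ (i, j) * ?s j + ?s j * E $$ (j, i) * ?s i)"
      unfolding delta by (simp add: algebra_simps)
    finally show ?thesis by (simp add: less_eq_complex_def)
  qed
  let ?Q = "\<Sum>i<d. \<Sum>j<d. ?s i * E $$ (i, j) * ?s j"
  have "0 \<le> (\<Sum>i<d. \<Sum>j<d. Re (E $$ (i, i) + E $$ (j, j) - (?s i * E $$ (i, j) * ?s j + ?s j * E $$ (j, i) * ?s i)))"
    by (intro sum_nonneg) (use pair in auto)
  also have "\<dots> = Re ((\<Sum>i<d. \<Sum>j<d. E $$ (i, i)) + (\<Sum>i<d. \<Sum>j<d. E $$ (j, j))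
      - (?Q + (\<Sum>i<d. \<Sum>j<d. ?s j * E $$ (j, i) * ?s i)))"
    by (simp only: Re_sum[symmetric] sum_subtractf sum.distrib)
  also have "(\<Sum>i<d. \<Sum>j<d. ?s j * E $$ (j, i) * ?s i) = ?Q" by (rule sum.swap)
  also have "(\<Sum>i<d. \<Sum>j<d. E $$ (i, i)) = of_nat d * mtrace E"
    using C by (simp add: mtrace_def sum_distrib_left)
  also have "(\<Sum>i<d. \<Sum>j<d. E $$ (j, j)) = of_nat d * mtrace E"
    using C by (simp add: mtrace_def)
  finally have "Re ?Q \<le> Re (mtrace E) * real d" by (simp add: mult.commute del: Re_sum)
  moreover have "mtrace (hstate d x * E) = ?Q / of_nat d"
    unfolding mtrace_mult[OF hstate_carrier C] sum_divide_distrib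
    by (subst sum.swap) (auto simp: mult_ac intro!: sum.cong)
  ultimately show ?thesis using d by (simp add: pos_divide_le_eq del: Re_sum)
qed

lemma DQ_hstate_bounds:
  assumes d: "0 < d"
  shows "0 < DQ d d (hstate d)" "DQ d d (hstate d) \<le> real d / 2 ^ d"
proof -
  let ?val = "\<lambda>E. (1 / real (card (hverts d))) * (\<Sum>x\<in>hverts d. Re (mtrace (hstate d x * E x)))"
  let ?V = "{?val E | E. povm d E (hverts d)}"
  have ub: "?val E \<le> real d / 2 ^ d" if E: "povm d E (hverts d)" for E
  proof -
    have psd: "psd d (E x)" if "x \<in> hverts d" for x using E that by (simp add: povm_def)
    have "(\<Sum>x\<in>hverts d. Re (mtrace (hstate d x * E x))) \<le> (\<Sum>x\<in>hverts d. Re (mtrace (E x)))"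
      by (intro sum_mono mtrace_hstate_le psd d)
    also have "\<dots> = Re (\<Sum>x\<in>hverts d. \<Sum>i<d. E x $$ (i, i))"
      using psd by (auto simp: mtrace_def psd_def simp del: Re_sum intro!: arg_cong[of _ _ Re] sum.cong simp flip: Re_sum)
    also have "\<dots> = Re (\<Sum>i<d. \<Sum>x\<in>hverts d. E x $$ (i, i))" by (subst sum.swap) simp
    also have "\<dots> = real d" using E by (simp add: povm_def del: Re_sum)
    finally show ?thesis by (simp add: card_hverts divide_right_mono)
  qed
  \<comment> \<open>The uniform measurement shows that the set under the supremum is nonempty and
    that the supremum is positive, as the denominator of the final ratio must be.\<close>
  define E where "E = (\<lambda>x::vtx. 1 / of_nat (2 ^ d) \<cdot>\<^sub>m (1\<^sub>m d :: complex mat))"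
  have "psd d (E x)" for x
  proof -
    have "(\<Sum>i<d. \<Sum>j<d. cnj (v i) * E x $$ (i, j) * v j) = (\<Sum>i<d. cnj (v i) * v i / of_nat (2 ^ d))" for v
    proof -
      have "(\<Sum>i<d. \<Sum>j<d. cnj (v i) * E x $$ (i, j) * v j) =
          (\<Sum>i<d. \<Sum>j<d. if j = i then cnj (v i) * v i / of_nat (2 ^ d) else 0)"
        by (intro sum.cong) (auto simp: E_def)
      then show ?thesis by simp
    qed
    then show ?thesis unfolding psd_iff
      by (simp only:) (intro conjI allI sum_nonneg cnj_mult_self_nonneg, simp add: E_def)
  qed
  then have E: "povm d E (hverts d)" by (auto simp: povm_def E_def card_hverts)
  have "mtrace (hstate d x * E x) = 1 / of_nat (2 ^ d)" for x
    using mtrace_hstate[OF d, of x] d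
    by (simp add: E_def mult_smult_distrib[of _ d d] mtrace_def sum_divide_distrib[symmetric])
  then have "?val E = 1 / 2 ^ d" by (simp add: card_hverts)
  then have "1 / 2 ^ d \<in> ?V" using E by (metis (mono_tags, lifting) mem_Collect_eq)
  moreover have "bdd_above ?V" using ub by (auto intro!: bdd_aboveI)
  ultimately have "1 / 2 ^ d \<le> DQ d d (hstate d)" unfolding DQ_def by (rule cSup_upper)
  then show "0 < DQ d d (hstate d)" by (rule less_le_trans[rotated]) simp
  show "DQ d d (hstate d) \<le> real d / 2 ^ d"
    unfolding DQ_def using E ub by (intro cSup_least) auto
qed

theorem theorem5:
  fixes d :: nat
  assumes "0 < d" and "4 dvd d"
  shows "\<exists>k \<rho> M. qprotocol d k \<rho> M \<and> success d (qprob \<rho> M) = 1 \<and>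
           (\<forall>Msg pe pd. cprotocol d Msg pe pd \<and> success d (cprob Msg pe pd) = 1 \<longrightarrow>
              DC d Msg pe / DQ d k \<rho> \<ge> (1.005::real) ^ d / real d)"
proof -
  have even: "even d" using assms(2) by (meson dvd_trans even_numeral)
  \<comment> \<open>Bob tests for his own state. States of adjacent vertices are orthogonal, because
    their sign vectors agree in exactly half of the coordinates.\<close>
  define M where "M = (\<lambda>y z. if z = (1::nat) then hstate d y else 1\<^sub>m d - hstate d y)"
  have "qprotocol d d (hstate d) M"
    using assms(1) psd_hstate psd_one_minus_hstate mtrace_hstate
    by (auto simp: qprotocol_def density_def povm_def M_def)
  moreover have "success d (qprob (hstate d) M) = 1"
    unfolding success_eq using assms(1) even
    by (simp add: qprob_def M_def hnbrs_def mtrace_hstate_self mtrace_hstate_compl mtrace_hstate_adjacent)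
  moreover have "DC d Msg pe / DQ d d (hstate d) \<ge> 1.005 ^ d / real d"
    if "cprotocol d Msg pe pd" "success d (cprob Msg pe pd) = 1" for Msg pe pd
  proof -
    have DC: "1.005 ^ d \<le> DC d Msg pe * 2 ^ d" using DC_lower_bound assms that by blast
    have "(0::real) < 1.005 ^ d" by simp
    with DC have "0 < DC d Msg pe * 2 ^ d" by (rule less_le_trans[rotated])
    then have "0 < DC d Msg pe" by (rule zero_less_mult_pos2) simp
    have "1.005 ^ d / real d = (1.005 ^ d / 2 ^ d) / (real d / 2 ^ d)" by simp
    also have "\<dots> \<le> DC d Msg pe / DQ d d (hstate d)"
      using DC DQ_hstate_bounds[OF assms(1)] \<open>0 < DC d Msg pe\<close>
      by (intro frac_le) (auto simp: pos_divide_le_eq)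
    finally show ?thesis .
  qed
  ultimately show ?thesis by blast
qed

end
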